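(* Let $X$ be a random vector in $\mathbb{R}^d$ with $\mathbb{E}\|X\|<\infty$. Let $j\in\{1,\dots,d\}$, let $p\ge j$ be an integer, let $X_1,\dots,X_p$ be independent, identically distributed copies of $X$, and let $$Z_p:=\frac{1}{p}\left(\overline{X}_1+\dots+\overline{X}_p\right).$$ If $\varphi\in\mathbf{Val}_j$, then $$\mathbb{E}\,\varphi(Z_p)=\frac{p!}{p^j(p-j)!}\,\varphi(\mathsf{Z}_X).$$
   Context: $\mathbb{R}^d$ is Euclidean space with scalar product $\langle\cdot,\cdot\rangle$ and norm $\|\cdot\|$. $\mathcal{K}^d$ is the space of convex bodies (nonempty compact convex subsets) of $\mathbb{R}^d$ with the Hausdorff metric. Sums of sets are Minkowski sums. A function $\varphi:\mathcal{K}^d\to\mathbb{R}$ is a valuation if $\varphi(K\cup L)+\varphi(K\cap L)=\varphi(K)+\varphi(L)$ whenever $K,L,K\cup L\in\mathcal{K}^d$. $\mathbf{Val}$ is the real vector space of translation invariant, continuous (with respect to the Hausdorff metric) real valuations on $\mathcal{K}^d$, and $\mathbf{Val}_j$ is the subspace of those that are homogeneous of degree $j$, i.e. $\varphi(\lambda K)=\lambda^j\varphi(K)$ for all $\lambda> 0$ and $K\in\mathcal{K}^d$. For $x\in\mathbb{R}^d$, $\overline{x}$ denotes the closed segment with endpoints $x$ and the origin $o$. The support function of $K\in\mathcal{K}^d$ is $h(K,u):=\max\{\langle x,u\rangle:x\in K\}$, $u\in\mathbb{R}^d$. For a random vector $X$ in $\mathbb{R}^d$ with $\mathbb{E}\|X\|<\infty$,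 $\mathsf{Z}_X$ denotes the selection expectation $\mathbb{E}\,\overline{X}$ of the random segment $\overline{X}$; it is the convex body determined by $$h(\mathsf{Z}_X,u)=\mathbb{E}\,h(\overline{X},u)\quad\text{for all }u\in\mathbb{R}^d.$$ *)

theory Defs
  imports "HOL-Probability.Probability" "HOL-Library.Set_Algebras"
begin

definition convex_body :: "'a::euclidean_space set \<Rightarrow> bool" where
  "convex_body K \<longleftrightarrow> K \<noteq> {} \<and> compact K \<and> convex K"

(* Only used for convex bodies; both suprema are then maxima over compact sets. *)
definition hausdorff_dist :: "'a::euclidean_space set \<Rightarrow> 'a set \<Rightarrow> real" where
  "hausdorff_dist K L = max (SUP x\<in>K. infdist x L) (SUP y\<in>L. infdist y K)"

(* For a convex body the supremum is attained. *)
definition support_function :: "'a::euclidean_space set \<Rightarrow> 'a \<Rightarrow> real" where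
  "support_function K u = (SUP x\<in>K. x \<bullet> u)"

(* Functionals on convex bodies are represented by total functions on sets.
   All conditions below, and all uses, concern their values on convex bodies only. *)

definition is_valuation :: "('a::euclidean_space set \<Rightarrow> real) \<Rightarrow> bool" where
  "is_valuation \<phi> \<longleftrightarrow>
     (\<forall>K L. convex_body K \<longrightarrow> convex_body L \<longrightarrow> convex_body (K \<union> L) \<longrightarrow>
        \<phi> (K \<union> L) + \<phi> (K \<inter> L) = \<phi> K + \<phi> L)"

definition translation_invariant :: "('a::euclidean_space set \<Rightarrow> real) \<Rightarrow> bool" where
  "translation_invariant \<phi> \<longleftrightarrow> (\<forall>K x. convex_body K \<longrightarrow> \<phi> ((+) x ` K) = \<phi> K)"

definition hausdorff_continuous :: "('a::euclidean_space set \<Rightarrow> real) \<Rightarrow> bool" where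
  "hausdorff_continuous \<phi> \<longleftrightarrow>
     (\<forall>K. convex_body K \<longrightarrow>
        (\<forall>\<epsilon>>0. \<exists>\<delta>>0. \<forall>L. convex_body L \<longrightarrow> hausdorff_dist L K < \<delta> \<longrightarrow> \<bar>\<phi> L - \<phi> K\<bar> < \<epsilon>))"

definition Val :: "('a::euclidean_space set \<Rightarrow> real) set" where
  "Val = {\<phi>. is_valuation \<phi> \<and> translation_invariant \<phi> \<and> hausdorff_continuous \<phi>}"

definition Val_hom :: "nat \<Rightarrow> ('a::euclidean_space set \<Rightarrow> real) set" where
  "Val_hom j = {\<phi> \<in> Val. \<forall>(c::real)>0. \<forall>K. convex_body K \<longrightarrow> \<phi> ((*\<^sub>R) c ` K) = c ^ j * \<phi> K}"

(* Selection expectation of a random convex body, characterised by its support function.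
   A convex body is uniquely determined by its support function; the body exists
   whenever the norm of the random convex body is integrable. *)
definition selection_expectation :: "'w measure \<Rightarrow> ('w \<Rightarrow> 'a::euclidean_space set) \<Rightarrow> 'a set" where
  "selection_expectation M Y =
     (THE K. convex_body K \<and>
        (\<forall>u. support_function K u = (\<integral>\<omega>. support_function (Y \<omega>) u \<partial>M)))"

definition zonoid_of :: "'w measure \<Rightarrow> ('w \<Rightarrow> 'a::euclidean_space) \<Rightarrow> 'a set" where
  "zonoid_of M X = selection_expectation M (\<lambda>\<omega>. closed_segment 0 (X \<omega>))"

(* The sum over i is a Minkowski sum of sets. *)
definition mean_segments :: "nat \<Rightarrow> (nat \<Rightarrow> 'v \<Rightarrow> 'a::euclidean_space) \<Rightarrow> 'v \<Rightarrow> 'a set" where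
  "mean_segments p Xs \<omega> = (*\<^sub>R) (1 / real p) ` (\<Sum>i\<in>{1..p}. closed_segment 0 (Xs i \<omega>))"

end

theory Submission
  imports Defs
begin

text \<open>Cutting a Minkowski sum \<open>K + [0, (a + b) v]\<close> at \<open>K + a v\<close> shows that a translation
  invariant continuous valuation is affine in the length of each summand of a sum of segments.
  Hence homogeneity of degree \<open>j\<close> leaves only the square-free terms:
  \<open>\<phi> (\<Sum>i\<in>I. t\<^sub>i [0, v\<^sub>i]) = (\<Sum>J\<subseteq>I, |J| = j. (\<Prod>i\<in>J. t\<^sub>i) \<phi> (\<Sum>i\<in>J. [0, v\<^sub>i]))\<close>.
  This reduces the claim to \<open>E \<phi> ([0, X\<^sub>1] + \<dots> + [0, X\<^sub>j]) = j! \<phi> (Z)\<close> for the zonoid \<open>Z\<close> of \<open>X\<close>.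
  For finitely valued \<open>X\<close>, \<open>Z\<close> is the zonotope with summands \<open>P (X = x) [0, x]\<close>, and the
  identity is the expansion of \<open>\<phi> (Z)\<close> again. The general case follows by approximation with
  simple functions: the expansion gives \<open>|\<phi> ([0, x\<^sub>1] + \<dots> + [0, x\<^sub>j])| \<le> C |x\<^sub>1| \<cdots> |x\<^sub>j|\<close>,
  an integrable bound by independence.\<close>

section \<open>Convex bodies and support functions\<close>

lemma support_function_attained:
  assumes "convex_body K"
  obtains x where "x \<in> K" "support_function K u = x \<bullet> u" "\<And>y. y \<in> K \<Longrightarrow> y \<bullet> u \<le> x \<bullet> u"
proof -
  have "compact K" "K \<noteq> {}" using assms by (auto simp: convex_body_def)
  moreover have "continuous_on K (\<lambda>x. x \<bullet> u)" by (intro continuous_intros)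
  ultimately obtain x where x: "x \<in> K" "\<And>y. y \<in> K \<Longrightarrow> y \<bullet> u \<le> x \<bullet> u"
    using continuous_attains_sup[of K "\<lambda>x. x \<bullet> u"] by auto
  have "support_function K u = x \<bullet> u"
    unfolding support_function_def using x by (intro cSup_eq_maximum) auto
  with x show ?thesis by (intro that)
qed

lemma support_function_eqI:
  assumes "x \<in> K" "\<And>y. y \<in> K \<Longrightarrow> y \<bullet> u \<le> x \<bullet> u"
  shows "support_function K u = x \<bullet> u"
  unfolding support_function_def using assms by (intro cSup_eq_maximum) auto

lemma inner_le_support_function:
  assumes "convex_body K" "x \<in> K"
  shows "x \<bullet> u \<le> support_function K u"
  using support_function_attained[OF assms(1), of u] assms(2) by metis

lemma convex_body_plus:
  assumes "convex_body K" "convex_body L"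
  shows "convex_body (K + L)"
proof -
  have "K + L = {x + y | x y. x \<in> K \<and> y \<in> L}"
    by (auto simp: set_plus_def)
  then have "compact (K + L)"
    using compact_sums[of K L] assms by (simp add: convex_body_def)
  then show ?thesis
    using assms convex_set_plus[of K L] set_plus_intro[of _ K _ L] by (fastforce simp: convex_body_def)
qed

lemma support_function_plus:
  assumes "convex_body K" "convex_body L"
  shows "support_function (K + L) u = support_function K u + support_function L u"
proof -
  obtain x where x: "x \<in> K" "support_function K u = x \<bullet> u" "\<And>y. y \<in> K \<Longrightarrow> y \<bullet> u \<le> x \<bullet> u"
    using support_function_attained[OF assms(1)] by metis
  obtain z where z: "z \<in> L" "support_function L u = z \<bullet> u" "\<And>y. y \<in> L \<Longrightarrow> y \<bullet> u \<le> z \<bullet> u"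
    using support_function_attained[OF assms(2)] by metis
  have "support_function (K + L) u = (x + z) \<bullet> u"
    using x z by (intro support_function_eqI) (auto simp: set_plus_def inner_add_left intro!: add_mono)
  then show ?thesis using x z by (simp add: inner_add_left)
qed

lemma convex_body_segment [simp]: "convex_body (closed_segment x y)"
  by (simp add: convex_body_def)

lemma convex_body_singleton [simp]: "convex_body {x}"
  by (simp add: convex_body_def)

lemma support_function_singleton [simp]: "support_function {x} u = x \<bullet> u"
  by (simp add: support_function_def)

lemma support_function_segment [simp]:
  "support_function (closed_segment 0 x) u = max 0 (x \<bullet> u)"
proof (cases "x \<bullet> u \<ge> 0")
  case True
  then have "support_function (closed_segment 0 x) u = x \<bullet> u"
    by (intro support_function_eqI) (auto simp: in_segment mult_left_le_one_le)
  with True show ?thesis by simp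
next
  case False
  then have "support_function (closed_segment 0 x) u = 0 \<bullet> u"
    by (intro support_function_eqI) (auto simp: in_segment mult_nonneg_nonpos)
  with False show ?thesis by simp
qed

text \<open>For the point \<open>y\<close> of \<open>L\<close> nearest to \<open>x\<close>, the
  vector \<open>u = x - y\<close> is an outer normal of \<open>L\<close> at \<open>y\<close>.
  Testing the hypothesis in this direction gives
  \<open>norm u * norm u \<le> e * norm u\<close>.\<close>

lemma infdist_le_of_support_function_le:
  assumes K: "convex_body K" and L: "convex_body L" and "x \<in> K" and "e \<ge> 0"
    and le: "\<And>u. support_function K u \<le> support_function L u + e * norm u"
  shows "infdist x L \<le> e"
proof -
  have cl: "closed L" "convex L" "L \<noteq> {}"
    using L by (auto simp: convex_body_def compact_imp_closed)
  obtain y where y: "y \<in> L" "\<And>z. z \<in> L \<Longrightarrow> dist x y \<le> dist x z"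
    using distance_attains_inf[OF cl(1,3)] by metis
  define u where "u = x - y"
  have "z \<bullet> u \<le> y \<bullet> u" if "z \<in> L" for z
    using any_closest_point_dot[OF cl(2,1) y(1) that] y(2)
    by (simp add: u_def inner_diff_right inner_diff_left inner_commute)
  then have "support_function L u = y \<bullet> u"
    using y(1) by (intro support_function_eqI)
  moreover have "x \<bullet> u \<le> support_function K u"
    by (rule inner_le_support_function[OF K \<open>x \<in> K\<close>])
  ultimately have "u \<bullet> u \<le> e * norm u"
    using le[of u] by (simp add: u_def inner_diff_left)
  then have "norm u * norm u \<le> e * norm u"
    by (simp add: dot_square_norm power2_eq_square)
  then have "norm u \<le> e"
    using \<open>e \<ge> 0\<close> by (cases "u = 0") auto
  then show ?thesis
    using infdist_le[OF y(1), of x] by (simp add: u_def dist_norm)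
qed

text \<open>The nearest point argument applies in both directions. All Hausdorff estimates are made
  through this bound, as support functions turn Minkowski sums into sums of reals.\<close>

lemma hausdorff_dist_le_of_support_function:
  assumes "convex_body K" "convex_body L" "e \<ge> 0"
    and le: "\<And>u. \<bar>support_function K u - support_function L u\<bar> \<le> e * norm u"
  shows "hausdorff_dist K L \<le> e"
proof -
  have "support_function K u \<le> support_function L u + e * norm u"
    and "support_function L u \<le> support_function K u + e * norm u" for u
    using le[of u] by linarith+
  then show ?thesis
    unfolding hausdorff_dist_def using assms(1-3)
    by (intro max.boundedI cSUP_least infdist_le_of_support_function_le)
       (auto simp: convex_body_def)
qed

text \<open>This is the case \<open>e = 0\<close> of the distance estimate, since a point at
  distance 0 from a closed set belongs to it. It reduces identities between zonotopes to identities
  between real sums and gives the uniqueness behind \<open>selection_expectation\<close>.\<close>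

lemma convex_body_eqI:
  assumes K: "convex_body K" and L: "convex_body L"
    and eq: "\<And>u. support_function K u = support_function L u"
  shows "K = L"
proof -
  have "A \<subseteq> B" if "convex_body A" "convex_body B"
    "\<And>u. support_function A u = support_function B u" for A B :: "'a set"
  proof
    fix x assume "x \<in> A"
    then have "infdist x B \<le> 0"
      using that by (intro infdist_le_of_support_function_le[OF that(1,2)]) auto
    then have "infdist x B = 0"
      using infdist_nonneg[of x B] by linarith
    then show "x \<in> B"
      using that(2) in_closed_iff_infdist_zero[of B x]
      by (auto simp: convex_body_def compact_imp_closed)
  qed
  then show ?thesis using assms by (metis subset_antisym)
qed

section \<open>Zonotopes\<close>

text \<open>Indices are kept apart from vectors, so that a family can be restricted to subsets of
  \<open>I\<close>, vectors may repeat, and a finite set of vectors may index itself.\<close>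

definition zonotope :: "'i set \<Rightarrow> ('i \<Rightarrow> 'a::euclidean_space) \<Rightarrow> 'a set" where
  "zonotope I v = (\<Sum>i\<in>I. closed_segment 0 (v i))"

lemma zonotope_empty [simp]: "zonotope {} v = {0}"
  by (simp add: zonotope_def)

lemma zonotope_insert:
  "finite I \<Longrightarrow> i \<notin> I \<Longrightarrow> zonotope (insert i I) v = closed_segment 0 (v i) + zonotope I v"
  by (simp add: zonotope_def)

lemma zonotope_cong: "(\<And>i. i \<in> I \<Longrightarrow> v i = w i) \<Longrightarrow> zonotope I v = zonotope I w"
  by (simp add: zonotope_def)

text \<open>For infinite \<open>I\<close> the sum has the default value 0, which for sets is
  \<open>{0}\<close>, again a convex body.\<close>

lemma convex_body_zonotope [simp]: "convex_body (zonotope I v)"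
  unfolding zonotope_def
  by (induction I rule: infinite_finite_induct) (simp_all add: convex_body_plus)

lemma support_function_zonotope [simp]:
  "support_function (zonotope I v) u = (\<Sum>i\<in>I. max 0 (v i \<bullet> u))"
proof (induction I rule: infinite_finite_induct)
  case (insert i I)
  then show ?case by (simp add: zonotope_insert support_function_plus)
qed (simp_all add: zonotope_def)

lemma image_plus_linear:
  assumes "linear f"
  shows "f ` (A + B) = f ` A + f ` B"
  unfolding set_plus_image image_image
  by (intro set_eqI) (auto simp: image_iff linear_add[OF assms])

lemma scaleR_zonotope: "(*\<^sub>R) c ` zonotope I v = zonotope I (\<lambda>i. c *\<^sub>R v i)"
proof (induction I rule: infinite_finite_induct)
  case (insert i I)
  have "(*\<^sub>R) c ` (closed_segment 0 (v i) + zonotope I v)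
      = (*\<^sub>R) c ` closed_segment 0 (v i) + (*\<^sub>R) c ` zonotope I v"
    by (rule image_plus_linear) (simp add: linear_iff algebra_simps)
  also have "(*\<^sub>R) c ` closed_segment 0 (v i) = closed_segment 0 (c *\<^sub>R v i)"
    using closed_segment_linear_image[of "(*\<^sub>R) c" 0 "v i"] by simp
  finally show ?case using insert by (simp add: zonotope_insert)
qed (simp_all add: zonotope_def)

lemma zonotope_image:
  assumes "finite I"
  shows "zonotope I v = zonotope (v ` I) (\<lambda>x. real (card {i \<in> I. v i = x}) *\<^sub>R x)"
proof (intro convex_body_eqI convex_body_zonotope)
  fix u
  have "(\<Sum>i\<in>I. max 0 (v i \<bullet> u)) = (\<Sum>x\<in>v ` I. \<Sum>i\<in>{i \<in> I. v i = x}. max 0 (v i \<bullet> u))"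
    using assms by (intro sum.image_gen)
  also have "\<dots> = (\<Sum>x\<in>v ` I. max 0 ((real (card {i \<in> I. v i = x}) *\<^sub>R x) \<bullet> u))"
    by (intro sum.cong) (auto simp: max_def mult_le_0_iff zero_le_mult_iff)
  finally show "support_function (zonotope I v) u
      = support_function (zonotope (v ` I) (\<lambda>x. real (card {i \<in> I. v i = x}) *\<^sub>R x)) u"
    by simp
qed

lemma zonotope_reindex:
  assumes "inj_on v I"
  shows "zonotope (v ` I) (\<lambda>x. x) = zonotope I v"
  by (intro convex_body_eqI) (simp_all add: sum.reindex[OF assms])

text \<open>The map \<open>max 0\<close> is 1-Lipschitz; the rest is Cauchy-Schwarz. In geometric
  terms, moving the endpoint of a segment moves the segment by no more than that.\<close>

lemma abs_max_inner_diff_le: "\<bar>max 0 (x \<bullet> u) - max 0 (y \<bullet> u)\<bar> \<le> norm (x - y) * norm u"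
proof -
  have "\<bar>max 0 (x \<bullet> u) - max 0 (y \<bullet> u)\<bar> \<le> \<bar>(x - y) \<bullet> u\<bar>"
    by (auto simp: max_def inner_diff_left)
  also have "\<dots> \<le> norm (x - y) * norm u"
    by (rule Cauchy_Schwarz_ineq2)
  finally show ?thesis .
qed

section \<open>Valuations on sums of segments\<close>

text \<open>With the parameter \<open>s\<close> running through \<open>{0..c}\<close>, cutting the
  sum along \<open>v\<close> becomes cutting a real interval.\<close>

lemma mem_plus_segment:
  assumes "c \<ge> 0"
  shows "z \<in> K + closed_segment 0 (c *\<^sub>R v) \<longleftrightarrow> (\<exists>k\<in>K. \<exists>s\<in>{0..c}. z = k + s *\<^sub>R v)"
proof -
  have "closed_segment 0 (c *\<^sub>R v) = (\<lambda>s. s *\<^sub>R v) ` closed_segment 0 c"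
    using closed_segment_linear_image[of "\<lambda>s. s *\<^sub>R v" 0 c] by (simp add: linear_iff algebra_simps)
  then show ?thesis
    using assms by (force simp: set_plus_def closed_segment_eq_real_ivl)
qed

text \<open>Cut \<open>K + [0, (a + b) v]\<close> into \<open>K + [0, a v]\<close> and \<open>K + [a v, (a + b) v]\<close>;
  by convexity of \<open>K\<close> the two parts meet exactly in \<open>K + a v\<close>.\<close>

lemma valuation_segment_add:
  assumes val: "is_valuation \<phi>" and tr: "translation_invariant \<phi>"
    and K: "convex_body K" and ab: "a \<ge> 0" "b \<ge> 0"
  shows "\<phi> (K + closed_segment 0 ((a + b) *\<^sub>R v)) + \<phi> K
    = \<phi> (K + closed_segment 0 (a *\<^sub>R v)) + \<phi> (K + closed_segment 0 (b *\<^sub>R v))"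
proof -
  define A where "A = K + closed_segment 0 (a *\<^sub>R v)"
  define B where "B = (+) (a *\<^sub>R v) ` (K + closed_segment 0 (b *\<^sub>R v))"
  have A: "z \<in> A \<longleftrightarrow> (\<exists>k\<in>K. \<exists>s\<in>{0..a}. z = k + s *\<^sub>R v)" for z
    unfolding A_def using ab by (intro mem_plus_segment)
  have B: "z \<in> B \<longleftrightarrow> (\<exists>k\<in>K. \<exists>s\<in>{a..a+b}. z = k + s *\<^sub>R v)" for z
  proof -
    have "z \<in> B \<longleftrightarrow> z - a *\<^sub>R v \<in> K + closed_segment 0 (b *\<^sub>R v)"
      unfolding B_def by (force simp: image_iff algebra_simps)
    also have "\<dots> \<longleftrightarrow> (\<exists>k\<in>K. \<exists>s\<in>{0..b}. z = k + (a + s) *\<^sub>R v)"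
      unfolding mem_plus_segment[OF ab(2)] by (simp add: algebra_simps)
    also have "\<dots> \<longleftrightarrow> (\<exists>k\<in>K. \<exists>s\<in>(+) a ` {0..b}. z = k + s *\<^sub>R v)"
      by blast
    also have "(+) a ` {0..b} = {a..a+b}"
      by simp
    finally show ?thesis .
  qed
  have un: "A \<union> B = K + closed_segment 0 ((a + b) *\<^sub>R v)"
  proof (intro set_eqI)
    fix z
    have "z \<in> K + closed_segment 0 ((a + b) *\<^sub>R v) \<longleftrightarrow> (\<exists>k\<in>K. \<exists>s\<in>{0..a+b}. z = k + s *\<^sub>R v)"
      using ab by (intro mem_plus_segment) auto
    moreover have "s \<in> {0..a+b} \<longleftrightarrow> s \<in> {0..a} \<or> s \<in> {a..a+b}" for s
      using ab by auto
    ultimately show "z \<in> A \<union> B \<longleftrightarrow> z \<in> K + closed_segment 0 ((a + b) *\<^sub>R v)"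
      unfolding Un_iff A B by metis
  qed
  have int: "A \<inter> B = (+) (a *\<^sub>R v) ` K"
  proof (intro set_eqI iffI)
    fix z assume "z \<in> A \<inter> B"
    then obtain k s l t where k: "k \<in> K" "0 \<le> s" "s \<le> a" "z = k + s *\<^sub>R v"
      and l: "l \<in> K" "a \<le> t" "t \<le> a + b" "z = l + t *\<^sub>R v"
      unfolding Int_iff A B by auto
    have "z - a *\<^sub>R v \<in> K"
    proof (cases "s = t")
      case True
      with k l show ?thesis by auto
    next
      case False
      with k l have "s < t" by auto
      \<comment> \<open>Since \<open>s \<le> a \<le> t\<close>, some convex combination of
        \<open>s\<close> and \<open>t\<close> equals \<open>a\<close>; \<open>p\<close> is its
        weight, and the same combination of \<open>k\<close> and \<open>l\<close> is
        \<open>z - a v\<close>.\<close>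
      define p where "p = (a - s) / (t - s)"
      have p: "0 \<le> p" "p \<le> 1" "p * (t - s) = a - s"
        using k l \<open>s < t\<close> by (auto simp: p_def)
      have kl: "k = z - s *\<^sub>R v" "l = z - t *\<^sub>R v" using k(4) l(4) by (simp_all add: algebra_simps)
      have "(1 - p) *\<^sub>R k + p *\<^sub>R l = z - (s + p * (t - s)) *\<^sub>R v"
        unfolding kl by (simp add: algebra_simps)
      then have "(1 - p) *\<^sub>R k + p *\<^sub>R l = z - a *\<^sub>R v"
        by (simp add: p)
      moreover have "(1 - p) *\<^sub>R k + p *\<^sub>R l \<in> K"
        using K k l p by (intro convexD) (auto simp: convex_body_def)
      ultimately show ?thesis by simp
    qed
    then show "z \<in> (+) (a *\<^sub>R v) ` K"
      by (intro image_eqI[of _ _ "z - a *\<^sub>R v"]) auto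
  next
    fix z assume "z \<in> (+) (a *\<^sub>R v) ` K"
    then obtain k where "k \<in> K" "z = k + a *\<^sub>R v" by (auto simp: add.commute)
    moreover have "a \<in> {0..a}" "a \<in> {a..a+b}" using ab by auto
    ultimately show "z \<in> A \<inter> B" unfolding Int_iff A B by blast
  qed
  have cb: "convex_body (K + closed_segment 0 x)" for x
    using K by (intro convex_body_plus) auto
  have "convex_body A" by (simp add: A_def cb)
  moreover have "convex_body B"
    using cb[of "b *\<^sub>R v"] unfolding B_def convex_body_def
    by (auto intro: compact_translation convex_translation)
  moreover have "convex_body (A \<union> B)" unfolding un by (rule cb)
  ultimately have "\<phi> (A \<union> B) + \<phi> (A \<inter> B) = \<phi> A + \<phi> B"
    using val by (simp add: is_valuation_def)
  moreover have "\<phi> (A \<inter> B) = \<phi> K" "\<phi> B = \<phi> (K + closed_segment 0 (b *\<^sub>R v))"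
    unfolding int unfolding B_def using tr K cb by (auto simp: translation_invariant_def)
  ultimately show ?thesis unfolding un [symmetric] by (simp add: A_def)
qed

text \<open>The filter is arbitrary because both limits at \<open>at_right 0\<close> and limits of
  sequences are taken. The bound \<open>d n\<close> on the support functions is also a bound on the
  Hausdorff distance.\<close>

lemma Val_tendsto:
  assumes "\<phi> \<in> Val" and K: "convex_body K" and L: "\<And>n. convex_body (L n)"
    and le: "\<And>n u. \<bar>support_function (L n) u - support_function K u\<bar> \<le> d n * norm u"
    and d: "(d \<longlongrightarrow> 0) F"
  shows "((\<lambda>n. \<phi> (L n)) \<longlongrightarrow> \<phi> K) F"
proof (rule tendstoI)
  fix e :: real assume "e > 0"
  then obtain \<delta> where \<delta>: "\<delta> > 0" "\<And>M. convex_body M \<Longrightarrow> hausdorff_dist M K < \<delta> \<Longrightarrow> \<bar>\<phi> M - \<phi> K\<bar> < e"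
    using assms(1) K by (auto simp: Val_def hausdorff_continuous_def) meson
  \<comment> \<open>Only a nonzero direction reveals that \<open>d n\<close> is nonnegative.\<close>
  obtain b :: 'a where "b \<in> Basis" using nonempty_Basis by blast
  then have d0: "d n \<ge> 0" for n using le[of n b] by (auto intro: order_trans[OF abs_ge_zero])
  have "hausdorff_dist (L n) K \<le> d n" for n
    by (intro hausdorff_dist_le_of_support_function K L d0 le)
  moreover have "\<forall>\<^sub>F n in F. d n < \<delta>"
    using d \<delta>(1) by (rule order_tendstoD)
  ultimately show "\<forall>\<^sub>F n in F. dist (\<phi> (L n)) (\<phi> K) < e"
    using \<delta>(2) L by (auto simp: dist_real_def elim!: eventually_mono intro: le_less_trans)
qed

text \<open>Cauchy's functional equation on the half line. Subtracting \<open>s * g 1\<close> leaves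
  an additive \<open>h\<close> that vanishes at the naturals and so has period 1. Bounded near 0, it
  is bounded on \<open>[0, 1]\<close> and thus everywhere, which forces an additive function to be
  0.\<close>

lemma additive_nonneg_imp_linear:
  fixes g :: "real \<Rightarrow> real"
  assumes add: "\<And>s t. s \<ge> 0 \<Longrightarrow> t \<ge> 0 \<Longrightarrow> g (s + t) = g s + g t"
    and lim: "(g \<longlongrightarrow> 0) (at_right 0)" and "t \<ge> 0"
  shows "g t = t * g 1"
proof -
  define h where "h s = g s - s * g 1" for s
  have h_add: "h (s + t) = h s + h t" if "s \<ge> 0" "t \<ge> 0" for s t
    using that by (simp add: h_def add algebra_simps)
  have h_mult: "h (real n * s) = real n * h s" if "s \<ge> 0" for n s
  proof (induction n)
    case 0
    then show ?case using h_add[of 0 0] by simp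
  next
    case (Suc n)
    then show ?case using h_add[of s "real n * s"] that by (simp add: algebra_simps)
  qed
  have "((\<lambda>s. g s - s * g 1) \<longlongrightarrow> 0 - 0 * g 1) (at_right 0)"
    by (intro tendsto_intros lim)
  then have "\<forall>\<^sub>F s in at_right 0. \<bar>h s\<bar> < 1"
    unfolding h_def by (auto dest: tendstoD[of _ _ _ 1] simp: dist_real_def)
  then obtain \<delta> where \<delta>: "\<delta> > 0" "\<And>s. 0 < s \<Longrightarrow> s < \<delta> \<Longrightarrow> \<bar>h s\<bar> < 1"
    unfolding eventually_at_right_field by auto
  obtain m :: nat where m: "m > 0" "1 / real m < \<delta>"
    using \<delta>(1) by (metis ex_inverse_of_nat_less inverse_eq_divide)
  have bound: "\<bar>h s\<bar> \<le> real m" if "0 \<le> s" "s \<le> 1" for s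
  proof (cases "s = 0")
    case True
    then show ?thesis using h_add[of 0 0] by simp
  next
    case False
    have "s / real m \<le> 1 / real m" using that by (intro divide_right_mono) auto
    then have "\<bar>h (s / real m)\<bar> < 1" using False that m by (intro \<delta>(2)) auto
    moreover have "h s = real m * h (s / real m)"
      using h_mult[of "s / real m" m] that m by simp
    ultimately show ?thesis using m by (simp add: abs_mult)
  qed
  \<comment> \<open>The integer part of \<open>n t\<close> contributes 0 to
    \<open>h (n t) = n h t\<close>, so the bound on \<open>[0, 1]\<close> applies for every
    \<open>n\<close>.\<close>
  have "real n * \<bar>h t\<bar> \<le> real m" for n
  proof -
    define x where "x = real n * t"
    have x: "x \<ge> 0" using \<open>t \<ge> 0\<close> by (simp add: x_def)
    define k where "k = nat \<lfloor>x\<rfloor>"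
    have k: "real k = of_int \<lfloor>x\<rfloor>" using x by (simp add: k_def)
    have "h (real k * 1) = 0" unfolding h_mult[OF zero_le_one] by (simp add: h_def)
    then have "h x = h (x - real k)"
      using h_add[of "real k" "x - real k"] x unfolding k by simp
    also have "\<bar>\<dots>\<bar> \<le> real m"
      unfolding k by (intro bound) linarith+
    finally show ?thesis using h_mult[OF \<open>t \<ge> 0\<close>, of n] by (simp add: x_def abs_mult)
  qed
  then have "\<bar>h t\<bar> = 0"
    by (metis abs_ge_zero abs_zero linorder_not_less order_le_less reals_Archimedean3)
  then show ?thesis by (simp add: h_def)
qed

text \<open>The increment \<open>g\<close> is additive by the cutting identity and tends to 0 with
  \<open>t\<close> by continuity, hence it is linear.\<close>

lemma Val_segment_affine:
  assumes \<phi>: "\<phi> \<in> Val" and K: "convex_body K" and "t \<ge> 0"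
  shows "\<phi> (K + closed_segment 0 (t *\<^sub>R v)) = (1 - t) * \<phi> K + t * \<phi> (K + closed_segment 0 v)"
proof -
  define g where "g t = \<phi> (K + closed_segment 0 (t *\<^sub>R v)) - \<phi> K" for t
  have "g t = t * g 1"
  proof (rule additive_nonneg_imp_linear)
    fix s t :: real assume "s \<ge> 0" "t \<ge> 0"
    then show "g (s + t) = g s + g t"
      using valuation_segment_add[of \<phi> K s t v] \<phi> K by (simp add: g_def Val_def)
  next
    have "((\<lambda>t. \<phi> (K + closed_segment 0 (t *\<^sub>R v))) \<longlongrightarrow> \<phi> K) (at_right 0)"
    proof (rule Val_tendsto[OF \<phi> K])
      show "convex_body (K + closed_segment 0 (t *\<^sub>R v))" for t
        by (intro convex_body_plus K convex_body_segment)
      show "\<bar>support_function (K + closed_segment 0 (t *\<^sub>R v)) u - support_function K u\<bar>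
          \<le> norm (t *\<^sub>R v) * norm u" for t u
        using abs_max_inner_diff_le[of "t *\<^sub>R v" u 0] by (simp add: support_function_plus K)
      have "((\<lambda>t. norm (t *\<^sub>R v)) \<longlongrightarrow> norm (0 *\<^sub>R v)) (at_right 0)"
        by (intro tendsto_intros)
      then show "((\<lambda>t. norm (t *\<^sub>R v)) \<longlongrightarrow> 0) (at_right 0)" by simp
    qed
    then have "((\<lambda>t. \<phi> (K + closed_segment 0 (t *\<^sub>R v)) - \<phi> K) \<longlongrightarrow> \<phi> K - \<phi> K) (at_right 0)"
      by (intro tendsto_intros)
    then show "(g \<longlongrightarrow> 0) (at_right 0)" by (simp add: g_def [abs_def])
  qed fact
  then show ?thesis by (simp add: g_def algebra_simps)
qed

text \<open>Induction with arbitrary \<open>K\<close>: the affine formula in \<open>t i\<close> has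
  two values of \<phi> as coefficients, one with body \<open>K\<close> and one with body
  \<open>K + [0, v i]\<close>, and the induction hypothesis expands both.\<close>

lemma Val_multiaffine:
  assumes "\<phi> \<in> Val" "finite I" "convex_body K"
  shows "\<exists>c. \<forall>t. (\<forall>i\<in>I. t i \<ge> 0) \<longrightarrow>
    \<phi> (K + zonotope I (\<lambda>i. t i *\<^sub>R v i)) = (\<Sum>J\<in>Pow I. c J * (\<Prod>i\<in>J. t i))"
  using assms(2,3)
proof (induction I arbitrary: K rule: finite_induct)
  case empty
  show ?case by (intro exI[of _ "\<lambda>_. \<phi> K"]) (simp flip: set_zero)
next
  case (insert i I)
  obtain c1 where c1: "\<And>t. \<forall>i\<in>I. t i \<ge> 0 \<Longrightarrow>
      \<phi> (K + zonotope I (\<lambda>i. t i *\<^sub>R v i)) = (\<Sum>J\<in>Pow I. c1 J * (\<Prod>i\<in>J. t i))"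
    using insert.IH[OF insert.prems] by blast
  obtain c2 where c2: "\<And>t. \<forall>i\<in>I. t i \<ge> 0 \<Longrightarrow>
      \<phi> (K + closed_segment 0 (v i) + zonotope I (\<lambda>i. t i *\<^sub>R v i)) = (\<Sum>J\<in>Pow I. c2 J * (\<Prod>i\<in>J. t i))"
    using insert.IH[OF convex_body_plus[OF insert.prems convex_body_segment]] by blast
  \<comment> \<open>Subsets without \<open>i\<close> keep the coefficient for \<open>K\<close>;
    those with \<open>i\<close> receive the difference of the expansions for
    \<open>K + [0, v i]\<close> and for \<open>K\<close>.\<close>
  define c where "c J = (if i \<in> J then c2 (J - {i}) - c1 (J - {i}) else c1 J)" for J
  show ?case
  proof (intro exI[of _ c] allI impI)
    fix t assume t: "\<forall>i\<in>insert i I. (t i :: real) \<ge> 0"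
    define Z where "Z = zonotope I (\<lambda>i. t i *\<^sub>R v i)"
    have notin: "i \<notin> J" if "J \<in> Pow I" for J using that insert.hyps by auto
    have "\<phi> (K + zonotope (insert i I) (\<lambda>i. t i *\<^sub>R v i)) = \<phi> ((K + Z) + closed_segment 0 (t i *\<^sub>R v i))"
      using insert.hyps by (simp add: zonotope_insert Z_def ac_simps)
    also have "\<dots> = (1 - t i) * \<phi> (K + Z) + t i * \<phi> ((K + Z) + closed_segment 0 (v i))"
      using t insert.prems unfolding Z_def
      by (intro Val_segment_affine assms convex_body_plus convex_body_zonotope) auto
    also have "(K + Z) + closed_segment 0 (v i) = (K + closed_segment 0 (v i)) + Z"
      by (simp add: ac_simps)
    also have "(1 - t i) * \<phi> (K + Z) + t i * \<phi> (K + closed_segment 0 (v i) + Z)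
      = (\<Sum>J\<in>Pow I. c1 J * (\<Prod>i\<in>J. t i)) + (\<Sum>J\<in>Pow I. (c2 J - c1 J) * (t i * (\<Prod>i\<in>J. t i)))"
      unfolding Z_def using t by (subst c1 c2, simp)+ (simp add: algebra_simps sum_distrib_left sum_subtractf)
    also have "(\<Sum>J\<in>Pow I. c1 J * (\<Prod>i\<in>J. t i)) = (\<Sum>J\<in>Pow I. c J * (\<Prod>i\<in>J. t i))"
      by (intro sum.cong refl) (simp add: c_def notin)
    also have "(\<Sum>J\<in>Pow I. (c2 J - c1 J) * (t i * (\<Prod>i\<in>J. t i)))
        = (\<Sum>J\<in>Pow I. c (insert i J) * (\<Prod>i\<in>insert i J. t i))"
    proof (intro sum.cong refl)
      fix J assume J: "J \<in> Pow I"
      then have "finite J" using insert.hyps finite_subset by auto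
      then show "(c2 J - c1 J) * (t i * (\<Prod>i\<in>J. t i)) = c (insert i J) * (\<Prod>i\<in>insert i J. t i)"
        using notin[OF J] by (simp add: c_def)
    qed
    also have "\<dots> = (\<Sum>J\<in>insert i ` Pow I. c J * (\<Prod>i\<in>J. t i))"
      using notin by (subst sum.reindex) (auto simp: inj_on_def insert_ident)
    also have "(\<Sum>J\<in>Pow I. c J * (\<Prod>i\<in>J. t i)) + \<dots> = (\<Sum>J\<in>Pow (insert i I). c J * (\<Prod>i\<in>J. t i))"
      unfolding Pow_insert using insert.hyps by (intro sum.union_disjoint [symmetric]) auto
    finally show "\<phi> (K + zonotope (insert i I) (\<lambda>i. t i *\<^sub>R v i)) = (\<Sum>J\<in>Pow (insert i I). c J * (\<Prod>i\<in>J. t i))" .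
  qed
qed

text \<open>Dilating by \<open>x\<close> multiplies the term of \<open>J\<close> by
  \<open>x ^ card J\<close> and the whole by \<open>x ^ j\<close>, so only the terms with
  \<open>card J = j\<close> survive. Their coefficients are found by inserting indicator functions
  for \<open>t\<close>.\<close>

lemma Val_hom_zonotope:
  assumes \<phi>: "\<phi> \<in> Val_hom j" and I: "finite I" and t: "\<And>i. i \<in> I \<Longrightarrow> t i \<ge> 0"
  shows "\<phi> (zonotope I (\<lambda>i. t i *\<^sub>R v i))
    = (\<Sum>J | J \<subseteq> I \<and> card J = j. (\<Prod>i\<in>J. t i) * \<phi> (zonotope J v))"
proof -
  have Val: "\<phi> \<in> Val" using \<phi> by (simp add: Val_hom_def)
  obtain c where c: "\<And>t. \<forall>i\<in>I. t i \<ge> 0 \<Longrightarrow>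
      \<phi> (zonotope I (\<lambda>i. t i *\<^sub>R v i)) = (\<Sum>J\<in>Pow I. c J * (\<Prod>i\<in>J. t i))"
    using Val_multiaffine[OF Val I convex_body_singleton[of 0], of v] by (auto simp flip: set_zero)
  define P where "P t k = (\<Sum>J | J \<subseteq> I \<and> card J = k. c J * (\<Prod>i\<in>J. t i))" for t k
  have P: "\<phi> (zonotope I (\<lambda>i. t i *\<^sub>R v i)) = P t j" if t: "\<forall>i\<in>I. t i \<ge> 0" for t
  proof -
    \<comment> \<open>A bound for all degrees \<open>card J\<close> and also for \<open>j\<close>,
      which may exceed \<open>card I\<close>.\<close>
    define n where "n = card I + j"
    \<comment> \<open>The coefficients of the difference of the two polynomials in \<open>x\<close>.
      It vanishes for every \<open>x > 0\<close>, so it has infinitely many roots and all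
      \<open>Q k\<close> are 0.\<close>
    define Q where "Q k = P t k - of_bool (k = j) * \<phi> (zonotope I (\<lambda>i. t i *\<^sub>R v i))" for k
    have "(\<Sum>k\<le>n. Q k * x ^ k) = 0" if x: "x > 0" for x :: real
    proof -
      have "(\<Sum>k\<le>n. P t k * x ^ k)
          = (\<Sum>k\<le>n. \<Sum>J | J \<in> Pow I \<and> card J = k. c J * (\<Prod>i\<in>J. x * t i))"
        by (intro sum.cong refl) (auto simp: P_def sum_distrib_right prod.distrib intro!: sum.cong)
      also have "\<dots> = (\<Sum>J\<in>Pow I. c J * (\<Prod>i\<in>J. x * t i))"
        using I by (intro sum.group) (auto simp: n_def intro: trans_le_add1 card_mono)
      also have "\<dots> = \<phi> (zonotope I (\<lambda>i. (x * t i) *\<^sub>R v i))"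
        using t x by (subst c) auto
      also have "\<dots> = \<phi> ((*\<^sub>R) x ` zonotope I (\<lambda>i. t i *\<^sub>R v i))"
        by (simp add: scaleR_zonotope)
      also have "\<dots> = x ^ j * \<phi> (zonotope I (\<lambda>i. t i *\<^sub>R v i))"
        using \<phi> x by (simp add: Val_hom_def)
      also have "\<dots> = (\<Sum>k\<le>n. of_bool (k = j) * \<phi> (zonotope I (\<lambda>i. t i *\<^sub>R v i)) * x ^ k)"
        by (simp add: n_def of_bool_def if_distrib[of "\<lambda>a. a * _"] cong: if_cong)
      finally show ?thesis by (simp add: Q_def left_diff_distrib sum_subtractf)
    qed
    then have "{0<..} \<subseteq> {x. (\<Sum>k\<le>n. Q k * x ^ k) = 0}" by auto
    then have "infinite {x. (\<Sum>k\<le>n. Q k * x ^ k) = 0}"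
      using finite_subset infinite_Ioi by blast
    then have "Q j = 0"
      unfolding polyfun_finite_roots by (simp add: n_def)
    then show ?thesis by (simp add: Q_def)
  qed
  have "c J = \<phi> (zonotope J v)" if J: "J \<subseteq> I" "card J = j" for J
  proof -
    \<comment> \<open>Among the sets \<open>L\<close> with \<open>j\<close> elements, only
      \<open>L = J\<close> avoids a zero factor.\<close>
    define s :: "_ \<Rightarrow> real" where "s i = of_bool (i \<in> J)" for i
    have "zonotope I (\<lambda>i. s i *\<^sub>R v i) = zonotope J v"
      using J I by (intro convex_body_eqI) (auto simp: s_def intro!: sum.mono_neutral_cong_right)
    then have "\<phi> (zonotope J v) = P s j"
      using P[of s] by (simp add: s_def)
    also have "\<dots> = (\<Sum>L | L \<subseteq> I \<and> card L = j. if L = J then c J else 0)"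
      unfolding P_def
    proof (intro sum.cong refl)
      fix L assume "L \<in> {L. L \<subseteq> I \<and> card L = j}"
      then have L: "finite L" "card L = j" using I finite_subset by auto
      show "c L * (\<Prod>i\<in>L. s i) = (if L = J then c J else 0)"
      proof (cases "L \<subseteq> J")
        case True
        then have "L = J" using L J I by (metis card_subset_eq finite_subset)
        then show ?thesis by (simp add: s_def)
      next
        case False
        then have "(\<Prod>i\<in>L. s i) = 0" using L by (intro prod_zero) (auto simp: s_def)
        with False show ?thesis by auto
      qed
    qed
    also have "\<dots> = c J" using J I by (simp add: sum.delta)
    finally show ?thesis by simp
  qed
  then show ?thesis
    using P[of t] t by (auto simp: P_def mult.commute intro!: sum.cong)
qed

text \<open>Merging equal segments leaves fewer than \<open>j\<close> of them, and then the
  expansion has no \<open>j\<close>-element subset to sum over.\<close>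

lemma Val_hom_zonotope_not_inj:
  assumes "\<phi> \<in> Val_hom j" "finite S" "card S = j" "\<not> inj_on y S"
  shows "\<phi> (zonotope S y) = 0"
proof -
  have "card (y ` S) < j"
    using assms by (metis card_image_le eq_card_imp_inj_on nless_le)
  then have *: "{J. J \<subseteq> y ` S \<and> card J = j} = {}"
    using assms(2) by (auto dest: card_mono[rotated])
  show ?thesis
    unfolding zonotope_image[OF assms(2)] using assms(2)
    by (subst Val_hom_zonotope[OF assms(1)]) (simp_all only: * sum.empty finite_imageI of_nat_0_le_iff)
qed

text \<open>With exactly \<open>j\<close> segments the expansion has a single term, so the lengths
  factor out and vectors of norm at most 1 remain. Shrinking these by \<open>c\<close> brings the
  zonotope close to \<open>{0}\<close>, where continuity gives a bound, and homogeneity undoes the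
  shrinking.\<close>

lemma Val_hom_zonotope_bound:
  assumes \<phi>: "\<phi> \<in> Val_hom j" and "j > 0"
  obtains C where "C \<ge> 0"
    "\<And>(I :: 'i set) x. finite I \<Longrightarrow> card I = j \<Longrightarrow> \<bar>\<phi> (zonotope I x)\<bar> \<le> C * (\<Prod>i\<in>I. norm (x i))"
proof -
  have hom: "\<phi> ((*\<^sub>R) c ` K) = c ^ j * \<phi> K" if "c > 0" "convex_body K" for c K
    using \<phi> that by (simp add: Val_hom_def)
  \<comment> \<open>Dilation fixes \<open>{0}\<close>, so homogeneity of positive degree makes
    \<phi> vanish there.\<close>
  have "2 ^ j * \<phi> {0} = 1 * \<phi> {0}" using hom[of 2 "{0}"] by simp
  moreover have "(1::real) < 2 ^ j" using \<open>j > 0\<close> by (intro one_less_power) auto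
  ultimately have "\<phi> {0} = 0" by simp
  moreover have "hausdorff_continuous \<phi>" using \<phi> by (simp add: Val_hom_def Val_def)
  ultimately obtain \<delta> where \<delta>: "\<delta> > 0"
    "\<And>L. convex_body L \<Longrightarrow> hausdorff_dist L {0} < \<delta> \<Longrightarrow> \<bar>\<phi> L\<bar> < 1"
    unfolding hausdorff_continuous_def
    by (metis convex_body_singleton diff_zero zero_less_one)
  \<comment> \<open>Then \<open>j\<close> segments of length at most \<open>c\<close> stay within
    \<delta>/2 of \<open>{0}\<close>, strictly below \<delta>.\<close>
  define c where "c = \<delta> / (2 * real j)"
  have c: "c > 0" using \<delta> \<open>j > 0\<close> by (simp add: c_def)
  have unit: "\<bar>\<phi> (zonotope I v)\<bar> \<le> 1 / c ^ j"
    if I: "finite I" "card I = j" and v: "\<And>i. i \<in> I \<Longrightarrow> norm (v i) \<le> 1" for I :: "'i set" and v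
  proof -
    have "hausdorff_dist (zonotope I (\<lambda>i. c *\<^sub>R v i)) {0} \<le> \<delta> / 2"
    proof (intro hausdorff_dist_le_of_support_function)
      fix u
      have "\<bar>\<Sum>i\<in>I. max 0 ((c *\<^sub>R v i) \<bullet> u)\<bar> \<le> (\<Sum>i\<in>I. \<bar>max 0 ((c *\<^sub>R v i) \<bullet> u)\<bar>)"
        by (rule sum_abs)
      also have "\<dots> \<le> (\<Sum>i\<in>I. c * norm u)"
      proof (intro sum_mono)
        fix i assume "i \<in> I"
        have "\<bar>max 0 ((c *\<^sub>R v i) \<bullet> u)\<bar> \<le> c * norm (v i) * norm u"
          using abs_max_inner_diff_le[of "c *\<^sub>R v i" u 0] c by simp
        also have "\<dots> \<le> c * 1 * norm u"
          using c v[OF \<open>i \<in> I\<close>] by (intro mult_right_mono mult_left_mono) auto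
        finally show "\<bar>max 0 ((c *\<^sub>R v i) \<bullet> u)\<bar> \<le> c * norm u" by simp
      qed
      also have "\<dots> = \<delta> / 2 * norm u" using I \<open>j > 0\<close> by (simp add: c_def)
      finally show "\<bar>support_function (zonotope I (\<lambda>i. c *\<^sub>R v i)) u - support_function {0} u\<bar> \<le> \<delta> / 2 * norm u"
        by simp
    qed (use \<delta> in auto)
    then have "\<bar>\<phi> (zonotope I (\<lambda>i. c *\<^sub>R v i))\<bar> < 1"
      using \<delta> by (intro \<delta>(2)) auto
    then have "c ^ j * \<bar>\<phi> (zonotope I v)\<bar> < 1"
      using hom[OF c, of "zonotope I v"] c by (simp add: scaleR_zonotope abs_mult)
    then show ?thesis using c by (simp add: field_simps)
  qed
  show ?thesis
  proof (rule that[of "1 / c ^ j"])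
    fix I :: "'i set" and x :: "'i \<Rightarrow> 'a"
    assume I: "finite I" "card I = j"
    \<comment> \<open>If \<open>x i = 0\<close>, then \<open>v i = 0\<close> as well, so both
      \<open>norm (v i) \<le> 1\<close> and \<open>norm (x i) *\<^sub>R v i = x i\<close>
      persist.\<close>
    define v where "v i = (1 / norm (x i)) *\<^sub>R x i" for i
    have "{J. J \<subseteq> I \<and> card J = j} = {I}"
      using I card_subset_eq by auto
    moreover have "(\<lambda>i. norm (x i) *\<^sub>R v i) = x"
      by (auto simp: v_def)
    ultimately have "\<phi> (zonotope I x) = (\<Prod>i\<in>I. norm (x i)) * \<phi> (zonotope I v)"
      using Val_hom_zonotope[OF \<phi> I(1), of "\<lambda>i. norm (x i)" v] by simp
    moreover have "\<bar>\<phi> (zonotope I v)\<bar> \<le> 1 / c ^ j"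
      by (intro unit I) (simp add: v_def)
    ultimately show "\<bar>\<phi> (zonotope I x)\<bar> \<le> 1 / c ^ j * (\<Prod>i\<in>I. norm (x i))"
      by (simp add: abs_mult abs_prod mult.commute[of "1 / c ^ j"] mult_left_mono prod_nonneg del: times_divide_eq_left times_divide_eq_right)
  qed (use c in simp)
qed

text \<open>Choices \<open>y\<close> that repeat a vector contribute 0, and each
  \<open>j\<close>-element subset of \<open>R\<close> is the image of \<open>j!\<close> injective
  ones with equal terms; what remains is the expansion of the right side. For point probabilities
  \<open>P\<close> the left side is the expectation over independent vectors with values in
  \<open>R\<close>.\<close>

lemma Val_hom_sum_zonotope:
  assumes \<phi>: "\<phi> \<in> Val_hom j" and R: "finite R" and S: "finite S" "card S = j"
    and P: "\<And>x. x \<in> R \<Longrightarrow> P x \<ge> 0"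
  shows "(\<Sum>y\<in>S \<rightarrow>\<^sub>E R. (\<Prod>i\<in>S. P (y i)) * \<phi> (zonotope S y))
    = fact j * \<phi> (zonotope R (\<lambda>x. P x *\<^sub>R x))"
proof -
  define T where "T = {J. J \<subseteq> R \<and> card J = j}"
  define D where "D = {y \<in> S \<rightarrow>\<^sub>E R. inj_on y S}"
  have fin: "finite (S \<rightarrow>\<^sub>E R)" "finite D" "finite T"
    using R S unfolding D_def T_def by (auto intro!: finite_PiE finite_Collect_conjI)
  have "(\<Sum>y\<in>S \<rightarrow>\<^sub>E R. (\<Prod>i\<in>S. P (y i)) * \<phi> (zonotope S y))
      = (\<Sum>y\<in>D. (\<Prod>i\<in>S. P (y i)) * \<phi> (zonotope S y))"
    using fin Val_hom_zonotope_not_inj[OF \<phi> S] by (intro sum.mono_neutral_right) (auto simp: D_def)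
  also have "\<dots> = (\<Sum>J\<in>T. \<Sum>y | y \<in> D \<and> y ` S = J. (\<Prod>i\<in>S. P (y i)) * \<phi> (zonotope S y))"
    using fin S by (intro sum.group [symmetric]) (auto simp: D_def T_def card_image)
  also have "\<dots> = (\<Sum>J\<in>T. fact j * ((\<Prod>x\<in>J. P x) * \<phi> (zonotope J (\<lambda>x. x))))"
  proof (intro sum.cong refl)
    fix J assume J: "J \<in> T"
    then have J': "finite J" "card J = j" "J \<subseteq> R" using R finite_subset by (auto simp: T_def)
    \<comment> \<open>An injective map between sets of \<open>j\<close> elements is onto.\<close>
    have eq: "{y. y \<in> D \<and> y ` S = J} = {y \<in> S \<rightarrow>\<^sub>E J. inj_on y S}"
    proof (intro set_eqI iffI; clarify)
      fix y assume y: "y \<in> S \<rightarrow>\<^sub>E J" "inj_on y S"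
      then have "y ` S = J"
        using J' S by (intro card_subset_eq) (auto simp: card_image)
      with y J' show "y \<in> D \<and> y ` S = J" by (auto simp: D_def)
    qed (auto simp: D_def PiE_iff)
    have card: "card {y \<in> S \<rightarrow>\<^sub>E J. inj_on y S} = fact j"
      using card_inj_on_subset_funcset[OF S(1) J'(1) subset_refl] S J' by (simp add: fact_prod_rev)
    have "(\<Prod>i\<in>S. P (y i)) * \<phi> (zonotope S y) = (\<Prod>x\<in>J. P x) * \<phi> (zonotope J (\<lambda>x. x))"
      if "y \<in> D \<and> y ` S = J" for y
    proof -
      have "inj_on y S" "J = y ` S" using that by (auto simp: D_def)
      then show ?thesis by (simp add: prod.reindex zonotope_reindex)
    qed
    then have "(\<Sum>y | y \<in> D \<and> y ` S = J. (\<Prod>i\<in>S. P (y i)) * \<phi> (zonotope S y))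
        = (\<Sum>y | y \<in> D \<and> y ` S = J. (\<Prod>x\<in>J. P x) * \<phi> (zonotope J (\<lambda>x. x)))"
      by (intro sum.cong) auto
    also have "\<dots> = real (card {y \<in> S \<rightarrow>\<^sub>E J. inj_on y S}) * ((\<Prod>x\<in>J. P x) * \<phi> (zonotope J (\<lambda>x. x)))"
      unfolding eq by simp
    finally show "(\<Sum>y | y \<in> D \<and> y ` S = J. (\<Prod>i\<in>S. P (y i)) * \<phi> (zonotope S y))
      = fact j * ((\<Prod>x\<in>J. P x) * \<phi> (zonotope J (\<lambda>x. x)))"
      unfolding card by simp
  qed
  also have "\<dots> = fact j * \<phi> (zonotope R (\<lambda>x. P x *\<^sub>R x))"
    using P by (simp add: Val_hom_zonotope[OF \<phi> R] T_def sum_distrib_left)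
  finally show ?thesis .
qed

section \<open>The zonoid of a random vector\<close>

lemma norm_integral_le:
  fixes f :: "'w \<Rightarrow> 'b::{banach, second_countable_topology}"
  assumes "integrable M f" "integrable M g" "\<And>x. x \<in> space M \<Longrightarrow> norm (f x) \<le> g x"
  shows "norm (\<integral>x. f x \<partial>M) \<le> (\<integral>x. g x \<partial>M)"
  using assms by (intro order_trans[OF integral_norm_bound] integral_mono integrable_norm)

text \<open>The zonoid is realised as the closure of the set of all \<open>E (g X)\<close> with measurable
  \<open>0 \<le> g \<le> 1\<close>; the support function in direction \<open>u\<close> is attained for \<open>g = 1\<close> where
  \<open>\<langle>X, u\<rangle> > 0\<close> and \<open>g = 0\<close> elsewhere.\<close>

lemma zonoid_exists:
  fixes X :: "'w \<Rightarrow> 'a::euclidean_space"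
  assumes X: "integrable M X"
  obtains K where "convex_body K" "\<And>u. support_function K u = (\<integral>\<omega>. max 0 (X \<omega> \<bullet> u) \<partial>M)"
proof -
  define G where "G = {g \<in> borel_measurable M. \<forall>\<omega>. 0 \<le> g \<omega> \<and> g \<omega> \<le> (1::real)}"
  define A where "A = (\<lambda>g. \<integral>\<omega>. g \<omega> *\<^sub>R X \<omega> \<partial>M) ` G"
  have [measurable]: "X \<in> borel_measurable M" using X by simp
  have int: "integrable M (\<lambda>\<omega>. g \<omega> *\<^sub>R X \<omega>)" if "g \<in> G" for g
    using that by (intro Bochner_Integration.integrable_bound[OF X])
      (auto simp: G_def intro!: mult_left_le_one_le)
  have int_max: "integrable M (\<lambda>\<omega>. max 0 (X \<omega> \<bullet> u))" for u
    using X by (intro integrable_max integrable_zero integrable_inner_left) auto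
  have "convex A"
  proof (rule convexI)
    fix x y and s t :: real assume "x \<in> A" "y \<in> A" and st: "0 \<le> s" "0 \<le> t" "s + t = 1"
    then obtain f g where fg: "f \<in> G" "g \<in> G"
      and xy: "x = (\<integral>\<omega>. f \<omega> *\<^sub>R X \<omega> \<partial>M)" "y = (\<integral>\<omega>. g \<omega> *\<^sub>R X \<omega> \<partial>M)"
      by (auto simp: A_def)
    have "s *\<^sub>R x + t *\<^sub>R y = (\<integral>\<omega>. (s * f \<omega> + t * g \<omega>) *\<^sub>R X \<omega> \<partial>M)"
      using int[OF fg(1)] int[OF fg(2)] by (simp add: xy scaleR_left_distrib flip: scaleR_scaleR)
    moreover have "(\<lambda>\<omega>. s * f \<omega> + t * g \<omega>) \<in> G"
      using fg st by (auto simp: G_def intro!: convex_bound_le)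
    ultimately show "s *\<^sub>R x + t *\<^sub>R y \<in> A" unfolding A_def by (rule image_eqI)
  qed
  have "norm x \<le> (\<integral>\<omega>. norm (X \<omega>) \<partial>M)" if x: "x \<in> A" for x
  proof -
    obtain g where g: "g \<in> G" "x = (\<integral>\<omega>. g \<omega> *\<^sub>R X \<omega> \<partial>M)" using x by (auto simp: A_def)
    then show ?thesis
      using X int[OF g(1)] by (auto intro!: norm_integral_le simp: G_def mult_left_le_one_le)
  qed
  then have "bounded A" by (auto simp: bounded_iff)
  have "(\<lambda>_. 0) \<in> G" by (simp add: G_def)
  then have "A \<noteq> {}" by (auto simp: A_def)
  show ?thesis
  proof (rule that)
    show "convex_body (closure A)"
      using \<open>convex A\<close> \<open>bounded A\<close> \<open>A \<noteq> {}\<close> by (simp add: convex_body_def convex_closure)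
  next
    fix u
    define g where "g \<omega> = (if X \<omega> \<bullet> u > 0 then 1 else 0 :: real)" for \<omega>
    have g: "g \<in> G" by (auto simp: G_def g_def [abs_def])
    define x where "x = (\<integral>\<omega>. g \<omega> *\<^sub>R X \<omega> \<partial>M)"
    have x: "x \<in> A" using g by (auto simp: A_def x_def)
    have "x \<bullet> u = (\<integral>\<omega>. (g \<omega> *\<^sub>R X \<omega>) \<bullet> u \<partial>M)"
      unfolding x_def using int[OF g] by (subst integral_inner_left) auto
    also have "\<dots> = (\<integral>\<omega>. max 0 (X \<omega> \<bullet> u) \<partial>M)"
      by (intro Bochner_Integration.integral_cong) (auto simp: g_def)
    finally have xu: "x \<bullet> u = (\<integral>\<omega>. max 0 (X \<omega> \<bullet> u) \<partial>M)" .
    have "y \<bullet> u \<le> x \<bullet> u" if y: "y \<in> A" for y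
    proof -
      obtain f where f: "f \<in> G" "y = (\<integral>\<omega>. f \<omega> *\<^sub>R X \<omega> \<partial>M)" using y by (auto simp: A_def)
      have "y \<bullet> u = (\<integral>\<omega>. (f \<omega> *\<^sub>R X \<omega>) \<bullet> u \<partial>M)"
        unfolding f using int[OF f(1)] by (subst integral_inner_left) auto
      also have "\<dots> \<le> (\<integral>\<omega>. max 0 (X \<omega> \<bullet> u) \<partial>M)"
      proof (intro integral_mono integrable_inner_left int f int_max)
        fix \<omega>
        have "f \<omega> * (X \<omega> \<bullet> u) \<le> f \<omega> * max 0 (X \<omega> \<bullet> u)"
          using f by (intro mult_left_mono) (auto simp: G_def)
        also have "\<dots> \<le> max 0 (X \<omega> \<bullet> u)"
          using f by (intro mult_left_le_one_le) (auto simp: G_def)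
        finally show "(f \<omega> *\<^sub>R X \<omega>) \<bullet> u \<le> max 0 (X \<omega> \<bullet> u)" by simp
      qed
      finally show ?thesis by (simp add: xu)
    qed
    \<comment> \<open>A closed half-space containing \<open>A\<close> contains its closure, so the
      maximum over \<open>A\<close> is also the maximum over the closure.\<close>
    then have "closure A \<subseteq> {y. u \<bullet> y \<le> x \<bullet> u}"
      by (intro closure_minimal closed_halfspace_le) (auto simp: inner_commute)
    then have "support_function (closure A) u = x \<bullet> u"
      using x closure_subset by (intro support_function_eqI) (auto simp: inner_commute)
    then show "support_function (closure A) u = (\<integral>\<omega>. max 0 (X \<omega> \<bullet> u) \<partial>M)"
      by (simp add: xu)
  qed
qed

text \<open>Existence of the body and its determination by the support function resolve the
  \<open>THE\<close>.\<close>

lemma zonoid_of: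
  assumes "integrable M X"
  shows convex_body_zonoid_of: "convex_body (zonoid_of M X)"
    and support_function_zonoid_of:
      "support_function (zonoid_of M X) u = (\<integral>\<omega>. max 0 (X \<omega> \<bullet> u) \<partial>M)"
proof -
  obtain K where K: "convex_body K" "\<And>u. support_function K u = (\<integral>\<omega>. max 0 (X \<omega> \<bullet> u) \<partial>M)"
    using zonoid_exists[OF assms] by metis
  have "zonoid_of M X = K"
    unfolding zonoid_of_def selection_expectation_def support_function_segment
    using K by (intro the_equality conjI allI convex_body_eqI) simp_all
  with K show "convex_body (zonoid_of M X)"
    "support_function (zonoid_of M X) u = (\<integral>\<omega>. max 0 (X \<omega> \<bullet> u) \<partial>M)" by simp_all
qed

section \<open>Expectations\<close>

text \<open>On the space, \<open>g (Y \<omega>)\<close> is a finite combination of indicators of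
  level sets of \<open>Y\<close>. No measurable structure on the range of \<open>Y\<close> enters,
  so \<open>Y\<close> may take functions as values and \<open>g\<close> may be arbitrary.\<close>

lemma (in prob_space) expectation_finite_range:
  fixes g :: "'b \<Rightarrow> real"
  assumes R: "finite R" and Y: "\<And>\<omega>. \<omega> \<in> space M \<Longrightarrow> Y \<omega> \<in> R"
    and ev: "\<And>y. y \<in> R \<Longrightarrow> Y -` {y} \<inter> space M \<in> events"
  shows "integrable M (\<lambda>\<omega>. g (Y \<omega>))"
    and "expectation (\<lambda>\<omega>. g (Y \<omega>)) = (\<Sum>y\<in>R. prob (Y -` {y} \<inter> space M) * g y)"
proof -
  let ?s = "\<lambda>\<omega>. \<Sum>y\<in>R. indicator (Y -` {y} \<inter> space M) \<omega> * g y"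
  have eq: "g (Y \<omega>) = ?s \<omega>" if "\<omega> \<in> space M" for \<omega>
  proof -
    have "?s \<omega> = (\<Sum>y\<in>R. if y = Y \<omega> then g y else 0)"
      using that by (intro sum.cong) (auto simp: indicator_def)
    then show ?thesis using R Y[OF that] by simp
  qed
  have int: "integrable M (\<lambda>\<omega>. indicator (Y -` {y} \<inter> space M) \<omega> * g y)" if "y \<in> R" for y
    using ev[OF that] by (intro integrable_mult_left integrable_real_indicator) (auto simp: less_top [symmetric])
  show "integrable M (\<lambda>\<omega>. g (Y \<omega>))"
    using int by (subst Bochner_Integration.integrable_cong[OF refl eq]) auto
  have "expectation (\<lambda>\<omega>. g (Y \<omega>)) = expectation ?s"
    by (intro Bochner_Integration.integral_cong eq refl)
  also have "\<dots> = (\<Sum>y\<in>R. prob (Y -` {y} \<inter> space M) * g y)"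
    using int by (subst Bochner_Integration.integral_sum) auto
  finally show "expectation (\<lambda>\<omega>. g (Y \<omega>)) = (\<Sum>y\<in>R. prob (Y -` {y} \<inter> space M) * g y)" .
qed

text \<open>The index set \<open>S\<close> is arbitrary so that the result applies to every
  \<open>j\<close>-element subfamily of the copies of \<open>X\<close>.\<close>

lemma expectation_zonotope:
  fixes M :: "'w measure" and X :: "'w \<Rightarrow> 'a::euclidean_space"
    and N :: "'v measure" and Xs :: "'i \<Rightarrow> 'v \<Rightarrow> 'a"
  assumes M: "prob_space M" and X: "integrable M X" and N: "prob_space N"
    and indep: "prob_space.indep_vars N (\<lambda>_. borel) Xs S"
    and distr: "\<And>i. i \<in> S \<Longrightarrow> distr N borel (Xs i) = distr M borel X"
    and \<phi>: "\<phi> \<in> Val_hom j" and S: "finite S" "card S = j" and "j > 0"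
  shows "integrable N (\<lambda>\<omega>. \<phi> (zonotope S (\<lambda>i. Xs i \<omega>)))"
    and "(\<integral>\<omega>. \<phi> (zonotope S (\<lambda>i. Xs i \<omega>)) \<partial>N) = fact j * \<phi> (zonoid_of M X)"
proof -
  interpret M: prob_space M by fact
  interpret N: prob_space N by fact
  have Val: "\<phi> \<in> Val" using \<phi> by (simp add: Val_hom_def)
  have X_meas [measurable]: "X \<in> borel_measurable M" using X by simp
  have Xs_meas: "Xs i \<in> borel_measurable N" if "i \<in> S" for i
    using indep that by (simp add: N.indep_vars_def2)
  \<comment> \<open>Simple functions approximating the identity of the vector space: the same
    \<open>f n\<close> is applied to \<open>X\<close> and to every \<open>Xs i\<close>, so equality
    in law is kept.\<close>
  obtain f :: "nat \<Rightarrow> 'a \<Rightarrow> 'a" where f: "\<And>n. simple_function borel (f n)"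
    and f_lim: "\<And>x. (\<lambda>n. f n x) \<longlonglongrightarrow> x" and f_bound: "\<And>n x. norm (f n x) \<le> 2 * norm x"
    using borel_measurable_implies_sequence_metric[of "\<lambda>x::'a. x" borel 0] by auto
  have f_meas [measurable]: "f n \<in> borel_measurable borel" for n
    using f by (rule borel_measurable_simple_function)
  define R where "R n = range (f n)" for n
  have R: "finite (R n)" for n using simple_functionD(1)[OF f[of n]] by (simp add: R_def)
  have level: "f n -` {y} \<in> sets borel" for n y
    using simple_functionD(2)[OF f[of n], of "{y}"] by simp
  \<comment> \<open>The weights \<open>P n y\<close> are the point probabilities of
    \<open>f n (X \<omega>)\<close>, which makes \<open>Z n\<close> its zonoid.\<close>
  define P where "P n y = M.prob (X -` (f n -` {y}) \<inter> space M)" for n y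
  define Z where "Z n = zonotope (R n) (\<lambda>y. P n y *\<^sub>R y)" for n

  \<comment> \<open>Convergence of the zonotopes \<open>Z n\<close> to the zonoid of
    \<open>X\<close>\<close>
  have X_int: "integrable M (\<lambda>\<omega>. norm (X \<omega>))" using X by (rule integrable_norm)
  have fX_int: "integrable M (\<lambda>\<omega>. f n (X \<omega>))" for n
    using f_bound by (intro Bochner_Integration.integrable_bound[OF integrable_mult_right[OF X_int, of 2]]) auto
  \<comment> \<open>The mean distance between \<open>f n (X \<omega>)\<close> and
    \<open>X \<omega>\<close> controls the support functions; dominated convergence with majorant
    \<open>3 * norm (X \<omega>)\<close> sends it to 0.\<close>
  define d where "d n = (\<integral>\<omega>. norm (f n (X \<omega>) - X \<omega>) \<partial>M)" for n
  have "d \<longlonglongrightarrow> (\<integral>\<omega>. 0 \<partial>M)"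
    unfolding d_def
  proof (rule integral_dominated_convergence)
    show "integrable M (\<lambda>\<omega>. 3 * norm (X \<omega>))" using X_int by simp
    show "AE \<omega> in M. (\<lambda>n. norm (f n (X \<omega>) - X \<omega>)) \<longlonglongrightarrow> 0"
      by (intro AE_I2 tendsto_norm_zero Lim_null[THEN iffD1] f_lim)
    show "AE \<omega> in M. norm (norm (f n (X \<omega>) - X \<omega>)) \<le> 3 * norm (X \<omega>)" for n
    proof (intro AE_I2)
      fix \<omega>
      have "norm (f n (X \<omega>) - X \<omega>) \<le> norm (f n (X \<omega>)) + norm (X \<omega>)"
        by (rule norm_triangle_ineq4)
      also have "\<dots> \<le> 3 * norm (X \<omega>)" using f_bound[of n "X \<omega>"] by simp
      finally show "norm (norm (f n (X \<omega>) - X \<omega>)) \<le> 3 * norm (X \<omega>)" by simp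
    qed
  qed simp_all
  then have d: "d \<longlonglongrightarrow> 0" by simp
  have h: "\<bar>support_function (Z n) u - support_function (zonoid_of M X) u\<bar> \<le> d n * norm u" for n u
  proof -
    have int: "integrable M (\<lambda>\<omega>. max 0 (Y \<omega> \<bullet> u))" if "integrable M Y" for Y
      using that by (intro integrable_max integrable_zero integrable_inner_left) auto
    have "support_function (Z n) u = (\<Sum>y\<in>R n. P n y * max 0 (y \<bullet> u))"
      unfolding Z_def support_function_zonotope
      by (intro sum.cong refl) (auto simp: P_def max_def mult_le_0_iff zero_le_mult_iff measure_le_0_iff)
    also have "\<dots> = (\<integral>\<omega>. max 0 (f n (X \<omega>) \<bullet> u) \<partial>M)"
      unfolding P_def using R[of n] measurable_sets[OF X_meas level]
      by (subst M.expectation_finite_range[of "R n" "\<lambda>\<omega>. f n (X \<omega>)"])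
        (auto simp: R_def vimage_def)
    finally have "support_function (Z n) u - support_function (zonoid_of M X) u
        = (\<integral>\<omega>. max 0 (f n (X \<omega>) \<bullet> u) - max 0 (X \<omega> \<bullet> u) \<partial>M)"
      using int[OF fX_int] int[OF X] by (simp add: support_function_zonoid_of[OF X])
    also have "\<bar>\<dots>\<bar> \<le> (\<integral>\<omega>. norm (f n (X \<omega>) - X \<omega>) * norm u \<partial>M)"
      unfolding real_norm_def [symmetric]
      using int[OF fX_int] int[OF X] fX_int X abs_max_inner_diff_le
      by (intro norm_integral_le) auto
    also have "\<dots> = d n * norm u" by (simp add: d_def)
    finally show ?thesis .
  qed
  have Z_lim: "(\<lambda>n. \<phi> (Z n)) \<longlonglongrightarrow> \<phi> (zonoid_of M X)"
    using Val convex_body_zonoid_of[OF X] _ h d by (rule Val_tendsto) (simp add: Z_def)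

  \<comment> \<open>The identity for finitely valued vectors\<close>
  define T where "T n \<omega> = \<phi> (zonotope S (\<lambda>i. f n (Xs i \<omega>)))" for n \<omega>
  have T: "integrable N (T n)" "(\<integral>\<omega>. T n \<omega> \<partial>N) = fact j * \<phi> (Z n)" for n
  proof -
    \<comment> \<open>Restriction to \<open>S\<close> puts the values into the finite set
      \<open>S \<rightarrow>\<^sub>E R n\<close>, where equality is decided on
      \<open>S\<close>.\<close>
    define Y where "Y \<omega> = restrict (\<lambda>i. f n (Xs i \<omega>)) S" for \<omega>
    have TY: "T n = (\<lambda>\<omega>. \<phi> (zonotope S (Y \<omega>)))"
      unfolding T_def Y_def by (intro ext arg_cong[of _ _ \<phi>] zonotope_cong) simp
    \<comment> \<open>An empty intersection would be \<open>UNIV\<close> instead of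
      \<open>space N\<close>.\<close>
    have S0: "S \<noteq> {}" using S \<open>j > 0\<close> by auto
    have level_Y: "Y -` {y} \<inter> space N = (\<Inter>i\<in>S. Xs i -` (f n -` {y i}) \<inter> space N)"
      if "y \<in> S \<rightarrow>\<^sub>E R n" for y
    proof -
      have "Y \<omega> = y \<longleftrightarrow> (\<forall>i\<in>S. f n (Xs i \<omega>) = y i)" for \<omega>
      proof
        assume "\<forall>i\<in>S. f n (Xs i \<omega>) = y i"
        then show "Y \<omega> = y"
          using that by (intro extensionalityI[of _ S]) (auto simp: Y_def PiE_def)
      qed (auto simp: Y_def)
      then show ?thesis using S0 by auto
    qed
    have prob_Xs: "N.prob (Xs i -` (f n -` {y}) \<inter> space N) = P n y" if "i \<in> S" for i y
    proof -
      have "N.prob (Xs i -` (f n -` {y}) \<inter> space N) = measure (distr N borel (Xs i)) (f n -` {y})"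
        using level by (subst measure_distr[OF Xs_meas[OF that]]) auto
      also have "\<dots> = P n y"
        unfolding distr[OF that] P_def using level by (subst measure_distr[OF X_meas]) auto
      finally show ?thesis .
    qed
    have prob_Y: "N.prob (Y -` {y} \<inter> space N) = (\<Prod>i\<in>S. P n (y i))" if "y \<in> S \<rightarrow>\<^sub>E R n" for y
      unfolding level_Y[OF that]
      using N.indep_varsD[OF indep S0 S(1) subset_refl, of "\<lambda>i. f n -` {y i}"] level prob_Xs by simp
    have fin: "finite (S \<rightarrow>\<^sub>E R n)" using R S by (intro finite_PiE) auto
    have range: "Y \<omega> \<in> S \<rightarrow>\<^sub>E R n" for \<omega> by (auto simp: Y_def R_def)
    have events: "Y -` {y} \<inter> space N \<in> N.events" if "y \<in> S \<rightarrow>\<^sub>E R n" for y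
      unfolding level_Y[OF that] using S S0 level Xs_meas
      by (intro sets.finite_INT) (auto intro: measurable_sets)
    show "integrable N (T n)"
      unfolding TY by (rule N.expectation_finite_range[OF fin range events])
    have "(\<integral>\<omega>. T n \<omega> \<partial>N) = (\<Sum>y\<in>S \<rightarrow>\<^sub>E R n. (\<Prod>i\<in>S. P n (y i)) * \<phi> (zonotope S y))"
      unfolding TY by (subst N.expectation_finite_range(2)[OF fin range events, where g = "\<lambda>y. \<phi> (zonotope S y)"])
        (simp_all add: prob_Y)
    also have "\<dots> = fact j * \<phi> (Z n)"
      unfolding Z_def by (intro Val_hom_sum_zonotope \<phi> R S) (simp add: P_def)
    finally show "(\<integral>\<omega>. T n \<omega> \<partial>N) = fact j * \<phi> (Z n)" .
  qed

  \<comment> \<open>Passage to the limit in the expectation\<close>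
  obtain C where C: "C \<ge> 0"
    "\<And>x. \<bar>\<phi> (zonotope S x)\<bar> \<le> C * (\<Prod>i\<in>S. norm (x i))"
    using Val_hom_zonotope_bound[OF \<phi> \<open>j > 0\<close>, where 'i = 'i] S by metis
  have T_lim: "(\<lambda>n. T n \<omega>) \<longlonglongrightarrow> \<phi> (zonotope S (\<lambda>i. Xs i \<omega>))" for \<omega>
    unfolding T_def
  proof (rule Val_tendsto[OF Val])
    have "(\<lambda>n. \<Sum>i\<in>S. norm (f n (Xs i \<omega>) - Xs i \<omega>)) \<longlonglongrightarrow> (\<Sum>i\<in>S. 0)"
      by (intro tendsto_sum tendsto_norm_zero Lim_null[THEN iffD1] f_lim)
    then show "(\<lambda>n. \<Sum>i\<in>S. norm (f n (Xs i \<omega>) - Xs i \<omega>)) \<longlonglongrightarrow> 0" by simp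
    show "\<bar>support_function (zonotope S (\<lambda>i. f n (Xs i \<omega>))) u
        - support_function (zonotope S (\<lambda>i. Xs i \<omega>)) u\<bar>
      \<le> (\<Sum>i\<in>S. norm (f n (Xs i \<omega>) - Xs i \<omega>)) * norm u" for n u
      unfolding support_function_zonotope sum_subtractf [symmetric] sum_distrib_right
      by (intro order_trans[OF sum_abs] sum_mono abs_max_inner_diff_le)
  qed simp_all
  \<comment> \<open>Independence reduces integrability of the product to that of each factor, which
    has the law of \<open>norm (X \<omega>)\<close>.\<close>
  have "integrable N (\<lambda>\<omega>. \<Prod>i\<in>S. norm (Xs i \<omega>))"
  proof (rule N.indep_vars_integrable[OF S(1)])
    show "N.indep_vars (\<lambda>_. borel) (\<lambda>i \<omega>. norm (Xs i \<omega>)) S"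
      by (rule N.indep_vars_compose2[OF indep]) simp
    fix i assume i: "i \<in> S"
    have "integrable (distr N borel (Xs i)) norm"
      unfolding distr[OF i] using X_int by (simp add: integrable_distr_eq)
    then show "integrable N (\<lambda>\<omega>. norm (Xs i \<omega>))"
      using Xs_meas[OF i] by (simp add: integrable_distr_eq)
  qed
  then have dom: "integrable N (\<lambda>\<omega>. C * 2 ^ j * (\<Prod>i\<in>S. norm (Xs i \<omega>)))"
    by (rule integrable_mult_right)
  \<comment> \<open>The factor \<open>2 ^ j\<close> comes from
    \<open>norm (f n x) \<le> 2 * norm x\<close> in each of the \<open>j\<close> factors.\<close>
  have T_bound: "norm (T n \<omega>) \<le> C * 2 ^ j * (\<Prod>i\<in>S. norm (Xs i \<omega>))" for n \<omega>
  proof -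
    have "norm (T n \<omega>) \<le> C * (\<Prod>i\<in>S. norm (f n (Xs i \<omega>)))"
      using C(2) by (simp add: T_def)
    also have "\<dots> \<le> C * (\<Prod>i\<in>S. 2 * norm (Xs i \<omega>))"
      using C(1) f_bound by (intro mult_left_mono prod_mono) auto
    finally show ?thesis using S by (simp add: prod.distrib mult.assoc)
  qed
  have meas: "T n \<in> borel_measurable N" for n using T(1) by simp
  \<comment> \<open>Measurability is inherited from the finitely valued \<open>T n\<close> as a
    pointwise limit.\<close>
  have meas_lim: "(\<lambda>\<omega>. \<phi> (zonotope S (\<lambda>i. Xs i \<omega>))) \<in> borel_measurable N"
    using T_lim meas by (rule borel_measurable_LIMSEQ_real)
  note dct = meas_lim meas dom AE_I2[OF T_lim] AE_I2[OF T_bound]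
  show "integrable N (\<lambda>\<omega>. \<phi> (zonotope S (\<lambda>i. Xs i \<omega>)))"
    by (rule integrable_dominated_convergence[OF dct])
  have "(\<lambda>n. \<integral>\<omega>. T n \<omega> \<partial>N) \<longlonglongrightarrow> (\<integral>\<omega>. \<phi> (zonotope S (\<lambda>i. Xs i \<omega>)) \<partial>N)"
    by (rule integral_dominated_convergence[OF dct])
  moreover have "(\<lambda>n. \<integral>\<omega>. T n \<omega> \<partial>N) \<longlonglongrightarrow> fact j * \<phi> (zonoid_of M X)"
    unfolding T(2) by (intro tendsto_intros Z_lim)
  ultimately show "(\<integral>\<omega>. \<phi> (zonotope S (\<lambda>i. Xs i \<omega>)) \<partial>N) = fact j * \<phi> (zonoid_of M X)"
    by (rule LIMSEQ_unique)
qed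

theorem theorem1:
  fixes M :: "'w measure" and X :: "'w \<Rightarrow> 'a::euclidean_space"
    and N :: "'v measure" and Xs :: "nat \<Rightarrow> 'v \<Rightarrow> 'a"
    and j p :: nat and \<phi> :: "'a set \<Rightarrow> real"
  assumes "prob_space M"
    and "X \<in> borel_measurable M"
    and "integrable M (\<lambda>\<omega>. norm (X \<omega>))"
    and "j \<in> {1..DIM('a)}"
    and "p \<ge> j"
    and "prob_space N"
    and "prob_space.indep_vars N (\<lambda>_. borel) Xs {1..p}"
    and "\<And>i. i \<in> {1..p} \<Longrightarrow> distr N borel (Xs i) = distr M borel X"
    and "\<phi> \<in> Val_hom j"
  shows "integrable N (\<lambda>\<omega>. \<phi> (mean_segments p Xs \<omega>)) \<and>
    (\<integral>\<omega>. \<phi> (mean_segments p Xs \<omega>) \<partial>N)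
      = fact p / (real p ^ j * fact (p - j)) * \<phi> (zonoid_of M X)"
proof -
  let ?J = "{J. J \<subseteq> {1..p} \<and> card J = j}"
  have X: "integrable M X"
    by (rule integrable_norm_cancel[OF assms(3,2)])
  \<comment> \<open>All segments carry the coefficient \<open>1 / p\<close>, so each
    \<open>j\<close>-element subset gets the factor \<open>(1 / p) ^ j\<close>.\<close>
  have expand: "\<phi> (mean_segments p Xs \<omega>)
      = (\<Sum>J\<in>?J. (1 / real p) ^ j * \<phi> (zonotope J (\<lambda>i. Xs i \<omega>)))" for \<omega>
  proof -
    have "mean_segments p Xs \<omega> = zonotope {1..p} (\<lambda>i. (1 / real p) *\<^sub>R Xs i \<omega>)"
      by (simp only: mean_segments_def zonotope_def [symmetric] scaleR_zonotope)
    then show ?thesis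
      by (simp add: Val_hom_zonotope[OF assms(9)])
  qed
  have J: "integrable N (\<lambda>\<omega>. \<phi> (zonotope J (\<lambda>i. Xs i \<omega>)))"
      "(\<integral>\<omega>. \<phi> (zonotope J (\<lambda>i. Xs i \<omega>)) \<partial>N) = fact j * \<phi> (zonoid_of M X)"
    if "J \<in> ?J" for J
  proof -
    have "prob_space.indep_vars N (\<lambda>_. borel) Xs J" "finite J"
      using that prob_space.indep_vars_subset[OF assms(6,7)] finite_subset by auto
    moreover have "distr N borel (Xs i) = distr M borel X" if "i \<in> J" for i
      using \<open>J \<in> ?J\<close> that by (intro assms(8)) auto
    moreover have "card J = j" "j > 0"
      using that assms(4) by auto
    ultimately show "integrable N (\<lambda>\<omega>. \<phi> (zonotope J (\<lambda>i. Xs i \<omega>)))"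
      "(\<integral>\<omega>. \<phi> (zonotope J (\<lambda>i. Xs i \<omega>)) \<partial>N) = fact j * \<phi> (zonoid_of M X)"
      using expectation_zonotope[OF assms(1) X assms(6) _ _ assms(9)] by blast+
  qed
  have "(\<integral>\<omega>. \<phi> (mean_segments p Xs \<omega>) \<partial>N)
      = (\<Sum>J\<in>?J. (1 / real p) ^ j * (fact j * \<phi> (zonoid_of M X)))"
    unfolding expand using J by (simp add: Bochner_Integration.integral_sum)
  \<comment> \<open>The summand does not depend on \<open>J\<close>; the number of subsets times
    \<open>fact j\<close> is the falling factorial \<open>p! / (p - j)!\<close>.\<close>
  also have "\<dots> = real (p choose j) * (1 / real p) ^ j * (fact j * \<phi> (zonoid_of M X))"
    using n_subsets[of "{1..p}" j] by simp
  also have "\<dots> = fact p / (real p ^ j * fact (p - j)) * \<phi> (zonoid_of M X)"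
    using assms(5) by (simp add: binomial_fact power_divide)
  finally show ?thesis
    unfolding expand using J by (auto intro!: Bochner_Integration.integrable_sum)
qed

end
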